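(* Let $k \geq 2$ be an integer. Every digraph $D$ with $\delta^+(D) \geq 2$ and digirth at least $8k-6$ contains a subdivision of $C(k,k)$.
   Context: Digraphs are finite, without loops or parallel arcs. $\delta^+(D)$ is the minimum out-degree of $D$. The digirth of $D$ is the length (number of arcs) of a shortest directed cycle ($+\infty$ if $D$ is acyclic). For positive integers $a,b$, $C(a,b)$ is the digraph which is the union of two internally vertex-disjoint directed paths from a vertex $x$ to a vertex $y$, of lengths (numbers of arcs) $a$ and $b$. A subdivision of a digraph $F$ is obtained by replacing each arc $uv$ by a directed path from $u$ to $v$; $D$ contains a subdivision of $F$ if some subdigraph of $D$ is a subdivision of $F$. *)

theory Defs
  imports
    "Graph_Theory.Digraph"
    "Graph_Theory.Arc_Walk"
    "Graph_Theory.Digraph_Component"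
    "Graph_Theory.Kuratowski"
    "HOL-Library.Extended_Nat"
begin

(* Meaningful for finite digraphs with at least one vertex only. *)
definition min_out_degree :: "('a, 'b) pre_digraph \<Rightarrow> nat" where
  "min_out_degree D = Min (out_degree D ` verts D)"

(* The infimum of the empty set in enat is \<infinity>, so acyclic digraphs have digirth \<infinity>. *)
definition digirth :: "('a, 'b) pre_digraph \<Rightarrow> enat" where
  "digirth D = (INF p \<in> {p. pre_digraph.cycle D p}. enat (length p))"

(* For positive a and b, the two paths run from vertex 0 to vertex a:
     0, 1, ..., a           using the arcs 0, ..., a - 1, and
     0, a + 1, ..., a + b - 1, a   using the arcs a, ..., a + b - 1.
   Arcs have identities of their own, so C(1,1) consists of two parallel arcs. *)
definition two_path_digraph :: "nat \<Rightarrow> nat \<Rightarrow> (nat, nat) pre_digraph" where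
  "two_path_digraph a b =
     \<lparr> verts = {..<a + b},
       arcs = {..<a + b},
       tail = (\<lambda>i. if i = a then 0 else i),
       head = (\<lambda>i. if i + 1 = a + b then a else i + 1) \<rparr>"

(* phi places the vertices of F in H, and P e is the path that replaces the arc e.
   Intended for loopless F: a loop has no replacement, since the ends of a
   nonempty path are distinct.  Arc-disjointness of the paths is not implied by
   their internal disjointness when F has parallel arcs. *)
definition directed_subdivision ::
  "('c, 'd) pre_digraph \<Rightarrow> ('a, 'b) pre_digraph \<Rightarrow> bool" where
  "directed_subdivision F H \<longleftrightarrow>
     wf_digraph F \<and> wf_digraph H \<and>
     (\<exists>(phi :: 'c \<Rightarrow> 'a) (P :: 'd \<Rightarrow> 'b awalk).
        inj_on phi (verts F) \<and>
        (\<forall>e \<in> arcs F. P e \<noteq> [] \<and>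
           pre_digraph.apath H (phi (tail F e)) (P e) (phi (head F e)) \<and>
           set (pre_digraph.inner_verts H (P e)) \<inter> phi ` verts F = {}) \<and>
        (\<forall>e \<in> arcs F. \<forall>f \<in> arcs F. e \<noteq> f \<longrightarrow>
           set (pre_digraph.inner_verts H (P e)) \<inter> set (pre_digraph.inner_verts H (P f)) = {} \<and>
           set (P e) \<inter> set (P f) = {}) \<and>
        verts H = phi ` verts F \<union> (\<Union>e \<in> arcs F. set (pre_digraph.inner_verts H (P e))) \<and>
        arcs H = (\<Union>e \<in> arcs F. set (P e)))"

definition contains_subdivision ::
  "('a, 'b) pre_digraph \<Rightarrow> ('c, 'd) pre_digraph \<Rightarrow> bool" where
  "contains_subdivision D F \<longleftrightarrow> (\<exists>H. subgraph H D \<and> directed_subdivision F H)"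

lemma wf_two_path_digraph:
  assumes "0 < a" "0 < b"
  shows "wf_digraph (two_path_digraph a b)"
  using assms by unfold_locales (auto simp: two_path_digraph_def)

lemma two_path_digraph_cas_first:
  assumes "0 < b" "n \<le> a"
  shows "pre_digraph.cas (two_path_digraph a b) (a - n) [a - n..<a] a"
  using assms(2)
proof (induction n)
  case (Suc n)
  then have "[a - Suc n..<a] = (a - Suc n) # [a - n..<a]"
    by (simp add: upt_conv_Cons Suc_diff_Suc)
  moreover have "Suc (a - Suc n) = a - n" "a - Suc n \<noteq> a" "a - n \<noteq> a + b"
    using Suc.prems assms(1) by auto
  ultimately show ?case using Suc
    by (simp add: pre_digraph.cas.simps two_path_digraph_def)
qed (simp add: pre_digraph.cas.simps)

lemma two_path_digraph_cas_second:
  assumes "n < b"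
  shows "pre_digraph.cas (two_path_digraph a b)
           (if Suc n = b then 0 else a + b - Suc n) [a + b - Suc n..<a + b] a"
  using assms
proof (induction n)
  case 0
  then have "[a + b - Suc 0..<a + b] = [a + b - Suc 0]"
    by (simp add: upt_conv_Cons)
  with 0 show ?case
    by (auto simp: pre_digraph.cas.simps two_path_digraph_def)
next
  case (Suc n)
  then have "[a + b - Suc (Suc n)..<a + b] = (a + b - Suc (Suc n)) # [a + b - Suc n..<a + b]"
    by (simp add: upt_conv_Cons Suc_diff_Suc)
  moreover have "a + b - Suc (Suc n) = a \<longleftrightarrow> Suc (Suc n) = b"
    using Suc.prems by auto
  moreover have "Suc (a + b - Suc (Suc n)) = a + b - Suc n" "a + b - Suc n \<noteq> a + b"
    using Suc.prems by auto
  moreover have "Suc n \<noteq> b"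
    using Suc.prems by auto
  ultimately show ?case
    using Suc by (simp add: pre_digraph.cas.simps two_path_digraph_def)
qed

lemma two_path_digraph_is_union:
  assumes "0 < a" "0 < b"
  defines "F \<equiv> two_path_digraph a b" and "P \<equiv> [0..<a]" and "Q \<equiv> [a..<a + b]"
  shows "pre_digraph.apath F 0 P a" and "length P = a"
    and "pre_digraph.apath F 0 Q a" and "length Q = b"
    and "set (pre_digraph.inner_verts F P) \<inter> set (pre_digraph.inner_verts F Q) = {}"
    and "set P \<inter> set Q = {}"
    and "verts F = set (pre_digraph.awalk_verts F 0 P) \<union> set (pre_digraph.awalk_verts F 0 Q)"
    and "arcs F = set P \<union> set Q"
proof -
  have Q_Cons: "Q = a # [Suc a..<a + b]"
    using assms(2) by (simp add: Q_def upt_conv_Cons)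
  have tail_P: "map (tail F) P = [0..<a]"
    by (auto simp: P_def F_def two_path_digraph_def intro!: map_idI)
  have tail_Q: "map (tail F) Q = 0 # [Suc a..<a + b]"
    by (auto simp: Q_Cons F_def two_path_digraph_def intro!: map_idI)
  have vP: "pre_digraph.awalk_verts F 0 P = [0..<a] @ [a]"
    using assms(1,2) tail_P
    by (simp add: pre_digraph.awalk_verts_conv) (auto simp: F_def P_def two_path_digraph_def)
  have vQ: "pre_digraph.awalk_verts F 0 Q = 0 # [Suc a..<a + b] @ [a]"
    using assms(1,2) tail_Q
    by (simp add: pre_digraph.awalk_verts_conv) (auto simp: F_def Q_def two_path_digraph_def)
  have "pre_digraph.cas F 0 P a"
    using two_path_digraph_cas_first[of b a a] assms(2) by (simp add: F_def P_def)
  then show "pre_digraph.apath F 0 P a"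
    using assms(1) by (auto simp: pre_digraph.apath_def pre_digraph.awalk_def vP)
      (auto simp: F_def P_def two_path_digraph_def)
  have "pre_digraph.cas F 0 Q a"
    using two_path_digraph_cas_second[of "b - 1" b a] assms(2) by (simp add: F_def Q_def)
  then show "pre_digraph.apath F 0 Q a"
    using assms(1) by (auto simp: pre_digraph.apath_def pre_digraph.awalk_def vQ)
      (auto simp: F_def Q_def two_path_digraph_def)
  show "length P = a" "length Q = b" "set P \<inter> set Q = {}"
    by (auto simp: P_def Q_def)
  show "set (pre_digraph.inner_verts F P) \<inter> set (pre_digraph.inner_verts F Q) = {}"
    using assms(1) by (auto simp: pre_digraph.inner_verts_def tail_P tail_Q upt_conv_Cons)
  show "verts F = set (pre_digraph.awalk_verts F 0 P) \<union> set (pre_digraph.awalk_verts F 0 Q)"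
    using assms(1,2) by (auto simp: vP vQ) (auto simp: F_def two_path_digraph_def)
  show "arcs F = set P \<union> set Q"
    by (auto simp: F_def P_def Q_def two_path_digraph_def)
qed

end

theory Submission
  imports Defs
begin

text \<open>Girth \<open>2k - 1\<close> suffices. In a minimal nonempty set closed under arcs, choose a nonempty set
  \<open>S\<close> and a vertex \<open>c\<close> outside \<open>S\<close> such that all arcs leaving \<open>S\<close> go to \<open>c\<close>, with \<open>S\<close> as small as
  possible. Minimality makes \<open>S\<close> strongly connected, and it rules out a single vertex separating
  some \<open>u \<in> S\<close> from \<open>c\<close>, so every \<open>u \<in> S\<close> has two internally disjoint paths to \<open>c\<close>. Let \<open>R\<close> be a
  path from \<open>c\<close> back to \<open>S\<close>, meeting \<open>S\<close> only in its end \<open>s\<close>. If \<open>R\<close> has fewer than \<open>k\<close> arcs, the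
  girth forces both paths from \<open>s\<close> to \<open>c\<close> to be long. Otherwise take a successor \<open>x\<close> of \<open>s\<close> in \<open>S\<close>:
  the two paths from \<open>x\<close> to \<open>c\<close> and a path from \<open>x\<close> to \<open>s\<close> in \<open>S\<close> combine to disjoint paths from \<open>x\<close>
  to \<open>s\<close> and to \<open>c\<close>. The former closes to a cycle through the arc \<open>sx\<close> and hence is long; the latter
  is continued along \<open>R\<close> to \<open>s\<close>.\<close>

section \<open>Directed paths of a relation\<close>

text \<open>Stated for a relation, so that it also applies to restrictions such as the arcs with
  tail in \<open>S\<close>. A path is its list of vertices: it has one arc fewer than the list has
  entries.\<close>

definition dipath :: "('a \<Rightarrow> 'a \<Rightarrow> bool) \<Rightarrow> 'a \<Rightarrow> 'a list \<Rightarrow> 'a \<Rightarrow> bool" where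
  "dipath E u xs v \<longleftrightarrow> xs \<noteq> [] \<and> hd xs = u \<and> last xs = v \<and> distinct xs \<and> successively E xs"

lemma dipath_singleton [simp]: "dipath E u [x] v \<longleftrightarrow> x = u \<and> x = v"
  by (auto simp: dipath_def)

lemma dipath_ends:
  assumes "dipath E u xs v"
  shows "u \<in> set xs" "v \<in> set xs"
  using assms by (auto simp: dipath_def)

lemma dipath_ConsI:
  assumes "E u w" "dipath E w xs v" "u \<notin> set xs"
  shows "dipath E u (u # xs) v"
  using assms by (auto simp: dipath_def successively_Cons)

lemma dipath_takeD: "dipath E u (xs @ z # ys) v \<Longrightarrow> dipath E u (xs @ [z]) z"
  and dipath_dropD: "dipath E u (xs @ z # ys) v \<Longrightarrow> dipath E z (z # ys) v"
  and dipath_spliceI: "dipath E u (xs @ [z]) z \<Longrightarrow> dipath E z (z # ys) v \<Longrightarrow>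
    set xs \<inter> set ys = {} \<Longrightarrow> dipath E u (xs @ z # ys) v"
  by (auto simp: dipath_def successively_append_iff successively_Cons hd_append)

lemma dipath_join:
  assumes "dipath E u xs v" "dipath E v ys w" "set xs \<inter> set ys = {v}"
  shows "dipath E u (xs @ tl ys) w"
proof -
  obtain xs' where xs: "xs = xs' @ [v]"
    using assms(1) by (metis append_butlast_last_id dipath_def)
  obtain ys' where ys: "ys = v # ys'"
    using assms(2) by (metis list.collapse dipath_def)
  have "v \<notin> set xs'"
    using assms(1) xs by (auto simp: dipath_def)
  then have "dipath E u (xs' @ v # ys') w"
    using assms by - (rule dipath_spliceI, auto simp: xs ys)
  then show ?thesis by (simp add: xs ys)
qed

lemma dipath_mono:
  assumes "dipath E u xs v" "\<And>a b. E a b \<Longrightarrow> E' a b"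
  shows "dipath E' u xs v"
  using assms by (auto simp: dipath_def elim: successively_mono)

lemma rtranclp_imp_dipath:
  assumes "(\<lambda>a b. E a b \<and> P b)\<^sup>*\<^sup>* u v" "P u"
  shows "\<exists>xs. dipath E u xs v \<and> (\<forall>x\<in>set xs. P x)"
  using assms
proof (induction rule: converse_rtranclp_induct)
  case base
  then have "dipath E v [v] v \<and> (\<forall>x\<in>set [v]. P x)" by simp
  then show ?case by blast
next
  case (step u w)
  then obtain xs where xs: "dipath E w xs v" "\<forall>x\<in>set xs. P x" by blast
  show ?case
  proof (cases "u \<in> set xs")
    case True
    then obtain ys zs where "xs = ys @ u # zs" by (auto simp: in_set_conv_decomp)
    with xs have "dipath E u (u # zs) v \<and> (\<forall>x\<in>set (u # zs). P x)"
      by (auto dest: dipath_dropD)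
    then show ?thesis by blast
  next
    case False
    with xs step have "dipath E u (u # xs) v \<and> (\<forall>x\<in>set (u # xs). P x)"
      by (auto intro: dipath_ConsI)
    then show ?thesis by blast
  qed
qed

text \<open>Each vertex but the last is the tail of an arc of the path, and the relation confines
  tails to \<open>S\<close>.\<close>

lemma dipath_closed_subset:
  assumes "dipath (\<lambda>a b. a \<in> S \<and> E a b) u xs v"
  shows "set xs \<subseteq> insert v S"
  using assms
proof (induction xs arbitrary: u)
  case (Cons x xs)
  show ?case
  proof (cases xs)
    case (Cons y ys)
    then have "x \<in> S" "dipath (\<lambda>a b. a \<in> S \<and> E a b) y xs v"
      using Cons.prems by (auto simp: dipath_def)
    then show ?thesis using Cons.IH by auto
  qed (use Cons.prems in auto)
qed (simp add: dipath_def)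

text \<open>A path that starts anywhere off \<open>x\<close> can be rerouted, from its first meeting point
  with the two paths onwards, along the one it meets.\<close>

lemma reroute_to_end:
  assumes P: "dipath E x P c" and Q: "dipath E x Q c" and PQ: "set P \<inter> set Q = {x, c}"
    and L: "dipath E u L c" and x: "x \<notin> set L"
  shows "\<exists>P' Q'. dipath E u P' c \<and> dipath E x Q' c \<and> set P' \<inter> set Q' = {c}"
proof -
  have "\<exists>z\<in>set L. z \<in> set P \<union> set Q"
    using dipath_ends(2)[OF L] dipath_ends(2)[OF P] by blast
  from split_list_first_prop[OF this] obtain L1 z L2 where
    L_eq: "L = L1 @ z # L2" and z: "z \<in> set P \<union> set Q"
    and L1: "\<forall>y\<in>set L1. y \<notin> set P \<union> set Q" by blast
  have main: "\<exists>P' Q'. dipath E u P' c \<and> dipath E x Q' c \<and> set P' \<inter> set Q' = {c}"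
    if P: "dipath E x P c" and Q: "dipath E x Q c" and PQ: "set P \<inter> set Q = {x, c}"
      and z: "z \<in> set P" and L1: "\<forall>y\<in>set L1. y \<notin> set P \<union> set Q" for P Q
  proof -
    obtain P1 P2 where P_eq: "P = P1 @ z # P2" using z by (auto simp: in_set_conv_decomp)
    \<comment> \<open>Since \<open>L\<close> avoids \<open>x\<close>, the vertex \<open>x\<close>
      comes strictly before \<open>z\<close> on \<open>P\<close>, so the part of \<open>P\<close>
      from \<open>z\<close> on meets \<open>Q\<close> only in \<open>c\<close>.\<close>
    have "z \<noteq> x" using x L_eq by auto
    then have "x \<in> set P1" using P P_eq by (cases P1) (auto simp: dipath_def)
    then have x_P2: "x \<notin> set (z # P2)" using P P_eq by (auto simp: dipath_def)
    have zc: "dipath E z (z # P2) c" using P P_eq by (auto dest: dipath_dropD)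
    have "dipath E u (L1 @ z # P2) c"
      using dipath_takeD[OF L[unfolded L_eq]] zc
      by (rule dipath_spliceI) (use L1 P_eq in auto)
    moreover have "set (L1 @ z # P2) \<inter> set Q = {c}"
    proof
      show "set (L1 @ z # P2) \<inter> set Q \<subseteq> {c}"
      proof
        fix y assume y: "y \<in> set (L1 @ z # P2) \<inter> set Q"
        then have "y \<in> set (z # P2)" using L1 by auto
        moreover from this have "y \<in> set P" by (auto simp: P_eq)
        ultimately have "y \<in> {x, c}" "y \<noteq> x" using y PQ x_P2 by blast+
        then show "y \<in> {c}" by blast
      qed
      show "{c} \<subseteq> set (L1 @ z # P2) \<inter> set Q"
        using dipath_ends(2)[OF zc] dipath_ends(2)[OF Q] by auto
    qed
    ultimately show ?thesis using Q by blast
  qed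
  from z show ?thesis
  proof
    assume "z \<in> set P"
    then show ?thesis using main[OF P Q PQ] L1 by blast
  next
    assume "z \<in> set Q"
    then show ?thesis using main[OF Q P] PQ L1 by blast
  qed
qed

text \<open>The mirror image of the preceding rerouting: follow one of the two paths up to the last
  vertex of \<open>L\<close> that lies on either, then follow \<open>L\<close> to \<open>s\<close>.
  As \<open>L\<close> avoids \<open>c\<close>, the part followed avoids \<open>c\<close> too and
  meets the other path only in \<open>x\<close>. The inclusions later keep the new paths within
  \<open>insert c S\<close>.\<close>

lemma reroute_from_start:
  assumes P: "dipath E x P c" and Q: "dipath E x Q c" and PQ: "set P \<inter> set Q = {x, c}"
    and L: "dipath E x L s" and c: "c \<notin> set L" and "s \<noteq> x"
  shows "\<exists>P' Q'. dipath E x P' s \<and> dipath E x Q' c \<and> set P' \<inter> set Q' = {x} \<and>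
    set P' \<subseteq> set L \<union> (set P \<union> set Q - {c}) \<and> set Q' \<subseteq> set P \<union> set Q"
proof -
  have "\<exists>z\<in>set L. z \<in> set P \<union> set Q"
    using dipath_ends(1)[OF L] dipath_ends(1)[OF P] by blast
  from split_list_last_prop[OF this] obtain L1 z L2 where
    L_eq: "L = L1 @ z # L2" and z: "z \<in> set P \<union> set Q"
    and L2: "\<forall>y\<in>set L2. y \<notin> set P \<union> set Q" by blast
  have main: "\<exists>P' Q'. dipath E x P' s \<and> dipath E x Q' c \<and> set P' \<inter> set Q' = {x} \<and>
      set P' \<subseteq> set L \<union> (set P \<union> set Q - {c}) \<and> set Q' \<subseteq> set P \<union> set Q"
    if P: "dipath E x P c" and Q: "dipath E x Q c" and PQ: "set P \<inter> set Q = {x, c}"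
      and z: "z \<in> set P" and L2: "\<forall>y\<in>set L2. y \<notin> set P \<union> set Q" for P Q
  proof -
    obtain P1 P2 where P_eq: "P = P1 @ z # P2" using z by (auto simp: in_set_conv_decomp)
    have "z \<noteq> c" using c L_eq by auto
    then have "c \<in> set P2" using P P_eq by (cases P2) (auto simp: dipath_def)
    then have c_P1: "c \<notin> set (P1 @ [z])" using P P_eq by (auto simp: dipath_def)
    have xz: "dipath E x (P1 @ [z]) z" using dipath_takeD P unfolding P_eq by fast
    have "dipath E x (P1 @ z # L2) s"
      using xz dipath_dropD[OF L[unfolded L_eq]]
      by (rule dipath_spliceI) (use L2 P_eq in auto)
    moreover have "set (P1 @ z # L2) \<inter> set Q = {x}"
    proof
      show "set (P1 @ z # L2) \<inter> set Q \<subseteq> {x}"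
      proof
        fix y assume y: "y \<in> set (P1 @ z # L2) \<inter> set Q"
        then have "y \<in> set (P1 @ [z])" using L2 by auto
        moreover from this have "y \<in> set P" by (auto simp: P_eq)
        ultimately have "y \<in> {x, c}" "y \<noteq> c" using y PQ c_P1 by blast+
        then show "y \<in> {x}" by blast
      qed
      show "{x} \<subseteq> set (P1 @ z # L2) \<inter> set Q"
        using dipath_ends(1)[OF xz] dipath_ends(1)[OF Q] by auto
    qed
    moreover have "set (P1 @ z # L2) \<subseteq> set L \<union> (set P \<union> set Q - {c})"
      using c_P1 L_eq P_eq by auto
    ultimately show ?thesis using Q by blast
  qed
  from z show ?thesis
  proof
    assume "z \<in> set P"
    then show ?thesis using main[OF P Q PQ] L2 by blast
  next
    assume "z \<in> set Q"
    then show ?thesis using main[OF Q P] PQ L2 by (metis Int_commute Un_commute)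
  qed
qed

section \<open>Minimal sets with a single exit\<close>

text \<open>In \<open>minimal\<close> the exit \<open>d\<close> ranges over
  \<open>insert c S\<close> because an arc leaving a subset of \<open>S\<close> can end nowhere
  else.\<close>

locale minimal_exit_set =
  fixes E :: "'a \<Rightarrow> 'a \<Rightarrow> bool" and S :: "'a set" and c :: 'a
  assumes exit_notin: "c \<notin> S"
    and exit: "\<And>a b. a \<in> S \<Longrightarrow> E a b \<Longrightarrow> b \<in> insert c S"
    and minimal: "\<And>T d. T \<noteq> {} \<Longrightarrow> T \<subseteq> S \<Longrightarrow> d \<in> insert c S \<Longrightarrow> d \<notin> T \<Longrightarrow>
      (\<And>a b. a \<in> T \<Longrightarrow> E a b \<Longrightarrow> b \<in> insert d T) \<Longrightarrow> T = S"
    and irrefl: "\<not> E a a"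
    and two_succ: "a \<in> S \<Longrightarrow> \<exists>b b'. b \<noteq> b' \<and> E a b \<and> E a b'"
begin

abbreviation inside :: "'a \<Rightarrow> 'a \<Rightarrow> bool" where
  "inside a b \<equiv> a \<in> S \<and> E a b"

text \<open>If \<open>c\<close> is not in \<open>R\<close>, then \<open>R\<close> lies in
  \<open>S\<close> and has \<open>d\<close> as its only exit, so minimality forces
  \<open>R = S\<close>; as \<open>d\<close> is not in \<open>R\<close>, it must be \<open>c\<close>.
  For \<open>d\<close> in \<open>S\<close> this means that \<open>d\<close> does not separate
  \<open>u\<close> from the exit; for \<open>d = c\<close> it gives strong connectivity of
  \<open>S\<close>.\<close>

lemma reach_avoiding:
  assumes "u \<in> S" "d \<in> insert c S" "d \<noteq> u"
  defines "R \<equiv> {b. (\<lambda>a b. inside a b \<and> b \<noteq> d)\<^sup>*\<^sup>* u b}"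
  shows "c \<in> R \<or> d = c \<and> S = R"
proof (rule disjCI)
  assume "\<not> (d = c \<and> S = R)"
  show "c \<in> R"
  proof (rule ccontr)
    assume c: "c \<notin> R"
    have R_step: "b \<in> R" if "a \<in> R" "inside a b" "b \<noteq> d" for a b
      using that unfolding R_def by (auto intro: rtranclp.rtrancl_into_rtrancl)
    have "R \<subseteq> S"
    proof
      fix b assume "b \<in> R"
      then have "(\<lambda>a b. inside a b \<and> b \<noteq> d)\<^sup>*\<^sup>* u b" by (simp add: R_def)
      then have "b \<in> insert c S"
        using assms(1) exit by (cases rule: rtranclp.cases) auto
      with c \<open>b \<in> R\<close> show "b \<in> S" by auto
    qed
    moreover have "d \<notin> R"
      using assms(3) by (auto simp: R_def elim: rtranclp.cases)
    moreover have "u \<in> R" by (simp add: R_def)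
    ultimately have "R = S"
      using minimal[of R d] R_step assms(2) by blast
    with \<open>d \<notin> R\<close> assms(2) \<open>\<not> (d = c \<and> S = R)\<close> show False by auto
  qed
qed

lemma path_to_exit_avoiding:
  assumes "u \<in> S" "d \<in> S" "d \<noteq> u"
  shows "\<exists>L. dipath inside u L c \<and> d \<notin> set L"
proof -
  have "(\<lambda>a b. inside a b \<and> b \<noteq> d)\<^sup>*\<^sup>* u c"
    using reach_avoiding[of u d] assms exit_notin by auto
  then show ?thesis using rtranclp_imp_dipath[of inside "\<lambda>b. b \<noteq> d" u c] assms by auto
qed

lemma path_within:
  assumes "u \<in> S" "v \<in> S"
  shows "\<exists>L. dipath inside u L v \<and> c \<notin> set L"
proof -
  \<comment> \<open>Steps into \<open>c\<close> are excluded, so of the alternatives in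
    \<open>reach_avoiding\<close> only \<open>S = R\<close> remains.\<close>
  have "\<not> (\<lambda>a b. inside a b \<and> b \<noteq> c)\<^sup>*\<^sup>* u c"
    using assms(1) exit_notin by (auto elim: rtranclp.cases)
  then have "(\<lambda>a b. inside a b \<and> b \<noteq> c)\<^sup>*\<^sup>* u v"
    using reach_avoiding[of u c] assms exit_notin by auto
  then show ?thesis
    using rtranclp_imp_dipath[of inside "\<lambda>b. b \<noteq> c" u v] assms exit_notin by metis
qed

lemma succ_within:
  assumes "u \<in> S"
  obtains v where "v \<in> S" "E u v" "v \<noteq> u"
  using two_succ[OF assms] exit[OF assms] irrefl by (metis insertE)

text \<open>Whitney's argument: the paths are built along a walk to the exit, backwards.\<close>

lemma two_paths_to_exit:
  assumes "u \<in> S"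
  shows "\<exists>P Q. dipath inside u P c \<and> dipath inside u Q c \<and> set P \<inter> set Q = {u, c}"
proof -
  have "inside\<^sup>*\<^sup>* u c"
  proof -
    obtain v where "v \<in> S" "E u v" "v \<noteq> u" using succ_within[OF assms] .
    then have "(\<lambda>a b. inside a b \<and> b \<noteq> v)\<^sup>*\<^sup>* u c"
      using reach_avoiding[of u v] assms exit_notin by auto
    then show ?thesis by (rule rtranclp_mono[THEN predicate2D, rotated]) auto
  qed
  \<comment> \<open>The backward induction starts at \<open>c\<close> itself, hence the
    guard.\<close>
  then have "u \<noteq> c \<longrightarrow> ?thesis"
  proof (induction rule: converse_rtranclp_induct)
    case (step u w)
    show ?case
    proof
      assume "u \<noteq> c"
      have "u \<in> S" "E u w" using step by auto
      have "u \<noteq> w" using irrefl \<open>E u w\<close> by auto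
      show "\<exists>P Q. dipath inside u P c \<and> dipath inside u Q c \<and> set P \<inter> set Q = {u, c}"
      proof (cases "w = c")
        case True
        \<comment> \<open>The arc to \<open>c\<close> is one path; the other leaves through a
          successor \<open>v\<close> in \<open>S\<close> and goes on to \<open>c\<close> avoiding
          \<open>u\<close>.\<close>
        obtain v where v: "v \<in> S" "E u v" "v \<noteq> u" using succ_within[OF \<open>u \<in> S\<close>] .
        then obtain L where L: "dipath inside v L c" "u \<notin> set L"
          using path_to_exit_avoiding[of v u] \<open>u \<in> S\<close> by auto
        have "dipath inside u [u, c] c" using True \<open>E u w\<close> \<open>u \<in> S\<close> \<open>u \<noteq> c\<close>
          by (simp add: dipath_def)
        moreover have "dipath inside u (u # L) c"
          using L v \<open>u \<in> S\<close> by (intro dipath_ConsI[of _ _ v]) auto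
        moreover have "set [u, c] \<inter> set (u # L) = {u, c}"
          using dipath_ends(2)[OF L(1)] by auto
        ultimately show ?thesis by blast
      next
        case False
        then have "w \<in> S" using exit \<open>u \<in> S\<close> \<open>E u w\<close> by auto
        obtain P Q where PQ: "dipath inside w P c" "dipath inside w Q c"
          "set P \<inter> set Q = {w, c}" using step.IH False by auto
        \<comment> \<open>A path from \<open>u\<close> avoiding \<open>w\<close> allows one of the
          two paths from \<open>w\<close> to be replaced by a path \<open>P'\<close> from
          \<open>u\<close>, which shares only \<open>c\<close> with the remaining path
          \<open>Q'\<close> from \<open>w\<close>. The arc from \<open>u\<close> to \<open>w\<close>
          then extends \<open>Q'\<close> to the second path from \<open>u\<close>.\<close>
        obtain L where "dipath inside u L c" "w \<notin> set L"
          using path_to_exit_avoiding[of u w] \<open>u \<in> S\<close> \<open>w \<in> S\<close> \<open>u \<noteq> w\<close> by auto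
        then obtain P' Q' where PQ': "dipath inside u P' c" "dipath inside w Q' c"
          "set P' \<inter> set Q' = {c}" using reroute_to_end[OF PQ] by blast
        have "u \<in> set P'" using dipath_ends(1)[OF PQ'(1)] .
        then have "dipath inside u (u # Q') c"
          using PQ' \<open>u \<in> S\<close> \<open>E u w\<close> \<open>u \<noteq> c\<close> by (intro dipath_ConsI[of _ _ w]) auto
        moreover have "set P' \<inter> set (u # Q') = {u, c}"
          using \<open>u \<in> set P'\<close> PQ'(3) by auto
        ultimately show ?thesis using PQ'(1) by blast
      qed
    qed
  qed simp
  then show ?thesis using assms exit_notin by auto
qed

text \<open>Lengths count vertices, so \<open>k < length A\<close> means at least \<open>k\<close>
  arcs; in \<open>girth\<close> the closing arc makes \<open>length xs\<close> the number of arcs of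
  the cycle.\<close>

lemma long_disjoint_paths:
  assumes k: "k \<ge> 2"
    and girth: "\<And>u xs v. dipath E u xs v \<Longrightarrow> E v u \<Longrightarrow> 2 * k - 1 \<le> length xs"
    and R: "dipath E c R s" and RS: "set R \<inter> S = {s}"
  shows "\<exists>x A y B. dipath E x A y \<and> dipath E x B y \<and> set A \<inter> set B = {x, y} \<and>
    k < length A \<and> k < length B"
proof -
  have s: "s \<in> S" "s \<noteq> c" using RS exit_notin by auto
  have inside_E: "dipath E u xs v" if "dipath inside u xs v" for u xs v
    using that by (rule dipath_mono) auto
  show ?thesis
  proof (cases "length R \<le> k")
    case True
    obtain R' where R': "R = R' @ [s]"
      using R by (metis append_butlast_last_id dipath_def)
    have "R' \<noteq> []" using R R' s by (auto simp: dipath_def)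
    then have "dipath E c R' (last R')" "E (last R') s" "s \<notin> set R'"
      using R R' by (auto simp: dipath_def successively_append_iff)
    \<comment> \<open>\<open>P\<close>, \<open>R'\<close> and the arc from the end of
      \<open>R'\<close> to \<open>s\<close> form a cycle with
      \<open>length P + length R' - 1\<close> arcs. As \<open>length R'\<close> is at most
      \<open>k - 1\<close>, the bound \<open>2 * k - 1\<close> leaves at least \<open>k + 1\<close>
      vertices for \<open>P\<close>.\<close>
    have long: "k < length P" if "dipath inside s P c" for P
    proof -
      have "set P \<subseteq> insert c S" using dipath_closed_subset[OF that] .
      then have "set P \<inter> set R' \<subseteq> {c}" using RS R' \<open>s \<notin> set R'\<close> by auto
      then have "set P \<inter> set R' = {c}"
        using dipath_ends(2)[OF that] dipath_ends(1)[OF \<open>dipath E c R' _\<close>] by auto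
      then have "dipath E s (P @ tl R') (last R')"
        using inside_E[OF that] \<open>dipath E c R' _\<close> by (intro dipath_join)
      then have "2 * k - 1 \<le> length P + (length R' - 1)"
        using girth \<open>E (last R') s\<close> by fastforce
      moreover have "length R' + 1 \<le> k" using True R' by simp
      ultimately show ?thesis using \<open>R' \<noteq> []\<close> by (cases R') auto
    qed
    obtain P Q where "dipath inside s P c" "dipath inside s Q c" "set P \<inter> set Q = {s, c}"
      using two_paths_to_exit[OF s(1)] by blast
    then show ?thesis using long inside_E by blast
  next
    case False
    \<comment> \<open>With \<open>x\<close> a successor of \<open>s\<close>, every path from
      \<open>x\<close> to \<open>s\<close> closes to a cycle.\<close>
    obtain x where x: "x \<in> S" "E s x" "x \<noteq> s" using succ_within[OF s(1)] .
    obtain P Q where PQ: "dipath inside x P c" "dipath inside x Q c" "set P \<inter> set Q = {x, c}"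
      using two_paths_to_exit[OF x(1)] by blast
    obtain L where L: "dipath inside x L s" "c \<notin> set L"
      using path_within[OF x(1) s(1)] by blast
    have subsets: "set P \<subseteq> insert c S" "set Q \<subseteq> insert c S" "set L \<subseteq> S"
      using dipath_closed_subset[OF PQ(1)] dipath_closed_subset[OF PQ(2)]
        dipath_closed_subset[OF L(1)] s(1) by auto
    obtain A Q' where A: "dipath inside x A s" and Q': "dipath inside x Q' c"
      and AQ': "set A \<inter> set Q' = {x}"
      and "set A \<subseteq> set L \<union> (set P \<union> set Q - {c})" "set Q' \<subseteq> set P \<union> set Q"
      using reroute_from_start[OF PQ L x(3)[symmetric]] by blast
    then have "set A \<subseteq> S" "set Q' \<subseteq> insert c S" using subsets by auto
    have "s \<in> set A" "s \<in> set R" "c \<in> set Q'" "c \<in> set R" "x \<in> set Q'" "x \<in> set A"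
      using dipath_ends[OF A] dipath_ends[OF R] dipath_ends[OF Q'] by auto
    \<comment> \<open>\<open>s\<close> lies on \<open>A\<close>, which shares only \<open>x\<close>
      with \<open>Q'\<close>. Hence \<open>R\<close>, which meets \<open>S\<close> only in
      \<open>s\<close>, meets \<open>Q'\<close> only in \<open>c\<close>.\<close>
    then have "s \<notin> set Q'" using AQ' x(3) by auto
    then have "set Q' \<inter> set R = {c}"
      using RS \<open>set Q' \<subseteq> insert c S\<close> \<open>c \<in> set Q'\<close> \<open>c \<in> set R\<close> by auto
    then have B: "dipath E x (Q' @ tl R) s"
      using inside_E[OF Q'] R by (intro dipath_join)
    obtain R' where "R = c # R'" using R by (metis list.collapse dipath_def)
    then have set_B: "set (Q' @ tl R) = set Q' \<union> set R"
      using \<open>c \<in> set Q'\<close> by auto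
    have "set A \<inter> set (Q' @ tl R) = {x, s}"
      unfolding set_B using RS \<open>set A \<subseteq> S\<close> AQ' \<open>s \<in> set A\<close> \<open>s \<in> set R\<close> by auto
    moreover have "k < length A"
      using girth[OF inside_E[OF A] x(2)] k by linarith
    moreover have "2 \<le> length Q'"
    proof -
      have "x \<noteq> c" using x(1) exit_notin by auto
      then have "card {x, c} \<le> card (set Q')"
        using \<open>c \<in> set Q'\<close> \<open>x \<in> set Q'\<close> by (intro card_mono) auto
      then show ?thesis using \<open>x \<noteq> c\<close> card_length[of Q'] by simp
    qed
    then have "k < length (Q' @ tl R)" using False by simp
    ultimately show ?thesis using inside_E[OF A] B by blast
  qed
qed

end

section \<open>Existence of a minimal exit set with a return path\<close>

text \<open>A reachable set of least size is strongly connected, which supplies the return path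
  \<open>R\<close>; finiteness supplies a smallest set with a single exit inside it.\<close>

lemma minimal_exit_set_exists:
  fixes E :: "'a \<Rightarrow> 'a \<Rightarrow> bool"
  assumes "finite V" "V \<noteq> {}"
    and closed: "\<And>a b. a \<in> V \<Longrightarrow> E a b \<Longrightarrow> b \<in> V"
    and irrefl: "\<And>a. \<not> E a a"
    and two_succ: "\<And>a. a \<in> V \<Longrightarrow> \<exists>b b'. b \<noteq> b' \<and> E a b \<and> E a b'"
  shows "\<exists>S c R s. minimal_exit_set E S c \<and> dipath E c R s \<and> set R \<inter> S = {s}"
proof -
  define reach where "reach v = {w. E\<^sup>*\<^sup>* v w}" for v
  obtain v where v: "v \<in> V" and v_min: "\<And>w. w \<in> V \<Longrightarrow> card (reach v) \<le> card (reach w)"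
    using ex_has_least_nat[of "\<lambda>v. v \<in> V" _ "\<lambda>v. card (reach v)"] \<open>V \<noteq> {}\<close> by auto
  have reach_V: "reach w \<subseteq> V" if "w \<in> V" for w
  proof
    fix x assume "x \<in> reach w"
    then have "E\<^sup>*\<^sup>* w x" by (simp add: reach_def)
    then show "x \<in> V" using that closed by (induction rule: rtranclp_induct) auto
  qed
  define W where "W = reach v"
  have W: "W \<subseteq> V" "finite W" "v \<in> W"
    using reach_V[OF v] \<open>finite V\<close> by (auto simp: W_def reach_def intro: finite_subset)
  \<comment> \<open>\<open>reach w\<close> lies in \<open>W\<close> by transitivity and cannot be
    smaller by the choice of \<open>v\<close>.\<close>
  have reach_W: "reach w = W" if "w \<in> W" for w
  proof (rule card_seteq)
    show "reach w \<subseteq> W" using that by (auto simp: W_def reach_def)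
    show "card W \<le> card (reach w)" using v_min that W by (auto simp: W_def)
  qed (fact W)
  have W_closed: "b \<in> W" if "a \<in> W" "E a b" for a b
    using that by (auto simp: W_def reach_def)
  define exit_pair where "exit_pair = (\<lambda>(S, c). S \<noteq> {} \<and> S \<subseteq> W \<and> c \<in> W - S \<and>
    (\<forall>a b. a \<in> S \<longrightarrow> E a b \<longrightarrow> b \<in> insert c S))"
  obtain b where "E v b" using two_succ[OF v] by blast
  then have "b \<in> W" "b \<noteq> v" using W_closed W irrefl by auto
  \<comment> \<open>Removing a vertex from the closed set \<open>W\<close> leaves a set with that
    vertex as its only exit; the successor \<open>b\<close> of \<open>v\<close> shows that it is
    nonempty.\<close>
  then have "exit_pair (W - {v}, v)"
    using W W_closed by (auto simp: exit_pair_def)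
  from ex_has_least_nat[of exit_pair _ "\<lambda>(S, c). card S", OF this] obtain S c where
    Sc: "exit_pair (S, c)" and min: "\<And>T d. exit_pair (T, d) \<Longrightarrow> card S \<le> card T"
    by auto
  have S: "S \<noteq> {}" "S \<subseteq> W" "c \<in> W" "c \<notin> S" "finite S"
    and S_exit: "\<And>a b. a \<in> S \<Longrightarrow> E a b \<Longrightarrow> b \<in> insert c S"
    using Sc W by (auto simp: exit_pair_def intro: finite_subset)
  have "minimal_exit_set E S c"
  proof
    show "T = S" if "T \<noteq> {}" "T \<subseteq> S" "d \<in> insert c S" "d \<notin> T"
      "\<And>a b. a \<in> T \<Longrightarrow> E a b \<Longrightarrow> b \<in> insert d T" for T d
    proof (rule card_seteq[OF S(5) that(2)])
      \<comment> \<open>The exit \<open>d\<close> lies in \<open>insert c S\<close>, hence in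
        \<open>W\<close>, so \<open>T\<close> and \<open>d\<close> compete with the pair chosen to
        minimize \<open>card S\<close>.\<close>
      show "card S \<le> card T" using that S by (intro min[of T d]) (auto simp: exit_pair_def)
    qed
  qed (use S S_exit irrefl two_succ W in auto)
  moreover have "\<exists>R s. dipath E c R s \<and> set R \<inter> S = {s}"
  proof -
    obtain t where "t \<in> S" using S by auto
    then have "E\<^sup>*\<^sup>* c t" using reach_W[OF S(3)] S(2) by (auto simp: reach_def)
    then obtain R where R: "dipath E c R t"
      using rtranclp_imp_dipath[of E "\<lambda>_. True"] by auto
    then have "\<exists>s\<in>set R. s \<in> S" using dipath_ends(2)[OF R] \<open>t \<in> S\<close> by auto
    from split_list_first_prop[OF this] obtain R1 s R2 where
      "R = R1 @ s # R2" "s \<in> S" "\<forall>y\<in>set R1. y \<notin> S" by blast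
    then have "dipath E c (R1 @ [s]) s \<and> set (R1 @ [s]) \<inter> S = {s}"
      using R dipath_takeD[of E c R1 s R2 t] by auto
    then show ?thesis by blast
  qed
  ultimately show ?thesis by blast
qed

section \<open>Subdivisions of two-path digraphs\<close>

text \<open>Positions at which a path with \<open>l\<close> arcs is cut into \<open>n\<close> segments: all segments but the last
  are single arcs.\<close>

definition cut :: "nat \<Rightarrow> nat \<Rightarrow> nat \<Rightarrow> nat" where
  "cut n l i = (if i < n then i else l)"

lemma cut_Suc:
  assumes "n \<le> l" "i < n"
  shows "cut n l i < cut n l (Suc i)" "cut n l (Suc i) \<le> l"
  using assms by (auto simp: cut_def)

lemma cut_le:
  assumes "n \<le> l"
  shows "cut n l i \<le> l"
  using assms by (auto simp: cut_def)

lemma cut_inj: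
  assumes "n \<le> l"
  shows "inj_on (cut n l) {..n}"
  using assms by (auto simp: cut_def inj_on_def)

lemma cut_gap:
  assumes "n \<le> l" "i \<le> n" "j < n"
  shows "cut n l i \<notin> {cut n l j<..<cut n l (Suc j)}"
  using assms by (auto simp: cut_def)

lemma cut_disjoint:
  assumes "n \<le> l" "i < n" "j < n" "i \<noteq> j"
  shows "{cut n l i..<cut n l (Suc i)} \<inter> {cut n l j..<cut n l (Suc j)} = {}"
  using assms by (auto simp: cut_def split: if_splits)

lemma cut_cover:
  assumes "0 < n" "n \<le> l"
  shows "{..<l} = (\<Union>i<n. {cut n l i..<cut n l (Suc i)})"
    and "{..l} = cut n l ` {..n} \<union> (\<Union>i<n. {cut n l i<..<cut n l (Suc i)})"
proof -
  show arcs: "{..<l} = (\<Union>i<n. {cut n l i..<cut n l (Suc i)})"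
  proof (intro set_eqI iffI)
    fix m assume "m \<in> {..<l}"
    \<comment> \<open>Segment \<open>i\<close> consists of the single position \<open>i\<close> for
      \<open>i < n - 1\<close>; all positions from \<open>n - 1\<close> on fall into the last
      segment.\<close>
    then show "m \<in> (\<Union>i<n. {cut n l i..<cut n l (Suc i)})"
      using assms by (intro UN_I[of "min m (n - 1)"]) (auto simp: cut_def)
  next
    fix m assume "m \<in> (\<Union>i<n. {cut n l i..<cut n l (Suc i)})"
    then obtain i where "i < n" "m < cut n l (Suc i)" by auto
    then show "m \<in> {..<l}" using cut_Suc(2)[OF assms(2), of i] by auto
  qed
  show "{..l} = cut n l ` {..n} \<union> (\<Union>i<n. {cut n l i<..<cut n l (Suc i)})"
  proof (intro set_eqI iffI)
    fix m assume "m \<in> {..l}"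
    then consider "m = l" | "m \<in> {..<l}" by fastforce
    then show "m \<in> cut n l ` {..n} \<union> (\<Union>i<n. {cut n l i<..<cut n l (Suc i)})"
    proof cases
      case 1
      then have "m = cut n l n" by (simp add: cut_def)
      then show ?thesis by auto
    next
      case 2
      then obtain i where "i < n" "cut n l i \<le> m" "m < cut n l (Suc i)"
        unfolding arcs by auto
      then show ?thesis by (cases "m = cut n l i") auto
    qed
  next
    fix m assume "m \<in> cut n l ` {..n} \<union> (\<Union>i<n. {cut n l i<..<cut n l (Suc i)})"
    then show "m \<in> {..l}"
      using cut_le[OF assms(2)] by (auto intro: order_trans[OF less_imp_le])
  qed
qed

section \<open>Arc paths cut into the pieces of a subdivision\<close>

context wf_digraph
begin

lemma awalk_verts_nth:
  assumes "cas u p v"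
  shows "i < length p \<Longrightarrow> awalk_verts u p ! i = tail G (p ! i)"
    and "awalk_verts u p ! length p = v"
proof -
  show "awalk_verts u p ! i = tail G (p ! i)" if "i < length p"
    using that by (auto simp: awalk_verts_conv nth_append)
  have "last (awalk_verts u p) = v" using awlast_if_cas[OF assms] .
  then show "awalk_verts u p ! length p = v"
    by (simp add: last_conv_nth length_awalk_verts)
qed

text \<open>Inner vertices and arcs of a segment become images of intervals of positions, open for
  vertices and half-open for arcs. Disjointness and covering of the pieces thereby reduce to the
  facts about \<open>cut\<close>.\<close>

lemma apath_segment:
  assumes "apath u p v" "i < j" "j \<le> length p"
  defines "q \<equiv> take (j - i) (drop i p)"
  shows "apath (awalk_verts u p ! i) q (awalk_verts u p ! j)"
    and "set (inner_verts q) = (!) (awalk_verts u p) ` {i<..<j}"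
    and "set q = (!) p ` {i..<j}"
    and "q \<noteq> []"
proof -
  have q_len: "length q = j - i" using assms by simp
  have q_nth: "q ! n = p ! (i + n)" if "n < j - i" for n
    using that assms by simp
  have split: "p = take i p @ q @ drop j p"
    using assms(2) unfolding q_def by (metis append_take_drop_id drop_drop le_add_diff_inverse2 less_imp_le)
  have cas: "cas u p v" using assms(1) by (auto simp: apath_def)
  have "apath u (take i p @ q @ drop j p) v" using assms(1) split by simp
  then have path: "apath (awlast u (take i p)) q (awlast (awlast u (take i p)) q)"
    and cas': "cas u (take i p) (awlast u (take i p))"
    using apath_append_iff[of u "take i p" "q @ drop j p" v] apath_append_iff[of _ q "drop j p" v]
    by (auto simp: apath_def)
  have start: "awlast u (take n p) = awalk_verts u p ! n" if "n \<le> length p" for n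
    using awalk_verts_take_conv[OF cas, of n] that
    by (simp add: last_conv_nth length_awalk_verts)
  have "awlast (awlast u (take i p)) q = awlast u (take i p @ q)"
    by (simp add: awlast_append)
  also have "take i p @ q = take j p"
    using assms(2) unfolding q_def by (metis le_add_diff_inverse less_imp_le take_add)
  finally show "apath (awalk_verts u p ! i) q (awalk_verts u p ! j)"
    using path start[of i] start[of j] assms by simp
  show "set q = (!) p ` {i..<j}"
  proof -
    have "set q = (\<lambda>n. p ! (i + n)) ` {..<j - i}"
    proof (intro set_eqI iffI)
      fix e assume "e \<in> set q"
      then show "e \<in> (\<lambda>n. p ! (i + n)) ` {..<j - i}"
        using q_len q_nth by (auto simp: in_set_conv_nth)
    next
      fix e assume "e \<in> (\<lambda>n. p ! (i + n)) ` {..<j - i}"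
      then obtain n where "n < length q" "e = q ! n" using q_len q_nth by auto
      then show "e \<in> set q" by simp
    qed
    also have "\<dots> = (!) p ` ((+) i ` {..<j - i})" by (simp add: image_image)
    also have "(+) i ` {..<j - i} = {i..<j}"
      using assms(2) image_add_atLeastLessThan[of i 0 "j - i"]
      by (simp add: lessThan_atLeast0 add.commute)
    finally show ?thesis .
  qed
  show "q \<noteq> []" using q_len assms(2) by auto
  show "set (inner_verts q) = (!) (awalk_verts u p) ` {i<..<j}"
  proof (intro set_eqI iffI)
    fix x assume "x \<in> set (inner_verts q)"
    \<comment> \<open>\<open>inner_verts\<close> drops the first tail, so its entry \<open>n\<close>
      is the tail of arc \<open>i + Suc n\<close> of \<open>p\<close>.\<close>
    then obtain n where "n < j - i - 1" "x = tail G (p ! (i + Suc n))"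
      using q_len q_nth by (auto simp: inner_verts_def in_set_conv_nth nth_tl)
    then show "x \<in> (!) (awalk_verts u p) ` {i<..<j}"
      using awalk_verts_nth(1)[OF cas, of "i + Suc n"] assms(3)
      by (intro image_eqI[of _ _ "i + Suc n"]) auto
  next
    fix x assume "x \<in> (!) (awalk_verts u p) ` {i<..<j}"
    then obtain m where m: "i < m" "m < j" "x = awalk_verts u p ! m" by auto
    then have "x = tail G (p ! m)" using awalk_verts_nth(1)[OF cas, of m] assms(3) by simp
    then have "x = inner_verts q ! (m - Suc i)" "m - Suc i < length (inner_verts q)"
      using m q_len q_nth[of "m - i"] by (auto simp: inner_verts_def nth_tl Suc_diff_Suc)
    then show "x \<in> set (inner_verts q)" by simp
  qed
qed

lemma apath_subgraph:
  assumes "apath u p v" "set (awalk_verts u p) \<subseteq> W" "set p \<subseteq> A"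
  shows "pre_digraph.apath \<lparr>verts = W, arcs = A, tail = tail G, head = head G\<rparr> u p v"
proof -
  let ?H = "\<lparr>verts = W, arcs = A, tail = tail G, head = head G\<rparr>"
  have "compatible G ?H" by (simp add: compatible_def)
  then have "pre_digraph.cas ?H = cas" "pre_digraph.awalk_verts ?H = awalk_verts"
    by (simp_all add: compatible_cas compatible_awalk_verts)
  then show ?thesis
    using assms hd_in_awalk_verts(2)[OF assms(1)]
    by (auto simp: apath_def pre_digraph.apath_def awalk_def pre_digraph.awalk_def)
qed

text \<open>The union \<open>H\<close> of the two paths is itself the subdivision: the cut points
  are the images of the vertices, the segments replace the arcs. Arc-disjointness is a hypothesis of
  its own, since both paths could be the same single arc.\<close>

lemma contains_two_path_subdivision:
  assumes p: "apath x p y" and q: "apath x q y"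
    and ab: "0 < a" "a \<le> length p" "0 < b" "b \<le> length q"
    and disj: "set (awalk_verts x p) \<inter> set (awalk_verts x q) = {x, y}"
    and arcs_disj: "set p \<inter> set q = {}"
  shows "contains_subdivision G (two_path_digraph a b)"
proof -
  let ?F = "two_path_digraph a b"
  define vp vq where "vp = awalk_verts x p" and "vq = awalk_verts x q"
  define H where "H = \<lparr>verts = set vp \<union> set vq, arcs = set p \<union> set q,
    tail = tail G, head = head G\<rparr>"
  define \<sigma> \<tau> where "\<sigma> = cut a (length p)" and "\<tau> = cut b (length q)"
  \<comment> \<open>The shared ends, with indices 0 and \<open>a\<close>, are read off the first
    path; for \<open>0 < i < b\<close> the index \<open>a + i\<close> stands for cut point
    \<open>i\<close> of the second path.\<close>
  define phi where "phi i = (if i \<le> a then vp ! \<sigma> i else vq ! \<tau> (i - a))" for i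
  define P where "P e = (if e < a then take (\<sigma> (Suc e) - \<sigma> e) (drop (\<sigma> e) p)
    else take (\<tau> (Suc (e - a)) - \<tau> (e - a)) (drop (\<tau> (e - a)) q))" for e
  have len: "length vp = Suc (length p)" "length vq = Suc (length q)"
    by (simp_all add: vp_def vq_def length_awalk_verts)
  have dist: "distinct vp" "distinct vq"
    using p q by (auto simp: vp_def vq_def apath_def)
  have cas: "cas x p y" "cas x q y" using p q by (auto simp: apath_def)
  have ends: "vp ! 0 = x" "vq ! 0 = x" "vp ! length p = y" "vq ! length q = y"
    using awalk_verts_nth(2)[OF cas(1)] awalk_verts_nth(2)[OF cas(2)]
      awhd_if_cas[OF cas(1)] awhd_if_cas[OF cas(2)]
    by (simp_all add: vp_def vq_def hd_conv_nth)
  have \<sigma>: "\<sigma> i < \<sigma> (Suc i)" "\<sigma> (Suc i) \<le> length p" if "i < a" for i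
    using that cut_Suc ab by (auto simp: \<sigma>_def)
  have \<tau>: "\<tau> i < \<tau> (Suc i)" "\<tau> (Suc i) \<le> length q" if "i < b" for i
    using that cut_Suc ab by (auto simp: \<tau>_def)
  have \<sigma>_ends: "\<sigma> 0 = 0" "\<sigma> a = length p" and \<tau>_ends: "\<tau> 0 = 0" "\<tau> b = length q"
    using ab by (auto simp: \<sigma>_def \<tau>_def cut_def)
  \<comment> \<open>Common vertices are \<open>x\<close> or \<open>y\<close>, and by distinctness
    each of these has only one position on either path.\<close>
  have cross: "i = 0 \<and> j = 0 \<or> i = length p \<and> j = length q"
    if "vp ! i = vq ! j" "i \<le> length p" "j \<le> length q" for i j
  proof -
    have "vp ! i \<in> set vp \<inter> set vq" using that len by (metis IntI le_imp_less_Suc nth_mem)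
    then have "vp ! i \<in> {x, y}" using disj by (simp add: vp_def vq_def)
    then show ?thesis
      using that ends dist len nth_eq_iff_index_eq[OF dist(1), of i 0]
        nth_eq_iff_index_eq[OF dist(2), of j 0]
        nth_eq_iff_index_eq[OF dist(1), of i "length p"]
        nth_eq_iff_index_eq[OF dist(2), of j "length q"]
      by auto
  qed
  \<comment> \<open>The tails of the arcs of a path are distinct, hence so are the arcs.\<close>
  have "distinct p" "distinct q"
    using dist by (auto simp: vp_def vq_def awalk_verts_conv distinct_map split: if_splits)

  have subH: "subgraph H G" and wfH: "wf_digraph H"
  proof -
    have "wf_digraph H"
    proof
      fix e assume "e \<in> arcs H"
      then show "tail H e \<in> verts H" "head H e \<in> verts H"
        using awalk_verts_arc1[of e] awalk_verts_arc2[OF awalkI_apath[OF p]]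
          awalk_verts_arc2[OF awalkI_apath[OF q]]
        by (auto simp: H_def vp_def vq_def)
    qed
    moreover have "verts H \<subseteq> verts G" "arcs H \<subseteq> arcs G"
      using awalkI_apath[OF p] awalkI_apath[OF q] by (auto simp: H_def vp_def vq_def)
    ultimately show "subgraph H G" "wf_digraph H"
      using wf_digraph by (auto simp: subgraph_def compatible_def H_def)
  qed
  have inner_H: "pre_digraph.inner_verts H = inner_verts"
    by (simp add: fun_eq_iff pre_digraph.inner_verts_def H_def)
  have pH: "pre_digraph.apath H x p y" and qH: "pre_digraph.apath H x q y"
    unfolding H_def using p q by (auto intro!: apath_subgraph simp: vp_def vq_def)
  have vH: "pre_digraph.awalk_verts H = awalk_verts"
    by (subst compatible_awalk_verts[of H G]) (auto simp: compatible_def H_def)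

  have first: "pre_digraph.apath H (vp ! \<sigma> e) (P e) (vp ! \<sigma> (Suc e))"
      "set (inner_verts (P e)) = (!) vp ` {\<sigma> e<..<\<sigma> (Suc e)}"
      "set (P e) = (!) p ` {\<sigma> e..<\<sigma> (Suc e)}" "P e \<noteq> []" if "e < a" for e
    using wf_digraph.apath_segment[OF wfH pH \<sigma>[OF that]] that
    by (simp_all add: P_def inner_H vH vp_def)
  have second: "pre_digraph.apath H (vq ! \<tau> e) (P (a + e)) (vq ! \<tau> (Suc e))"
      "set (inner_verts (P (a + e))) = (!) vq ` {\<tau> e<..<\<tau> (Suc e)}"
      "set (P (a + e)) = (!) q ` {\<tau> e..<\<tau> (Suc e)}" "P (a + e) \<noteq> []" if "e < b" for e
    using wf_digraph.apath_segment[OF wfH qH \<tau>[OF that]]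
    by (simp_all add: P_def inner_H vH vq_def)

  have phi_p: "phi i = vp ! \<sigma> i" if "i \<le> a" for i
    using that by (simp add: phi_def)
  \<comment> \<open>Vertex \<open>i\<close> of the second path of the pattern has index
    \<open>a + i\<close>, except that its ends carry the indices 0 and \<open>a\<close>.\<close>
  have phi_q: "phi (if i = 0 then 0 else if i = b then a else a + i) = vq ! \<tau> i" if "i \<le> b" for i
    using that ab ends \<sigma>_ends \<tau>_ends by (auto simp: phi_def)
  have verts_F: "verts ?F = {..a} \<union> (\<lambda>i. a + i) ` {0<..<b}"
  proof (intro set_eqI iffI)
    fix i assume "i \<in> verts ?F"
    then show "i \<in> {..a} \<union> (\<lambda>i. a + i) ` {0<..<b}"
      by (cases "i \<le> a") (auto simp: two_path_digraph_def intro!: image_eqI[of _ _ "i - a"])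
  qed (use ab in \<open>auto simp: two_path_digraph_def\<close>)
  have arcs_F: "arcs ?F = {..<a} \<union> (\<lambda>i. a + i) ` {..<b}"
  proof (intro set_eqI iffI)
    fix i assume "i \<in> arcs ?F"
    then show "i \<in> {..<a} \<union> (\<lambda>i. a + i) ` {..<b}"
      by (cases "i < a") (auto simp: two_path_digraph_def intro!: image_eqI[of _ _ "i - a"])
  qed (use ab in \<open>auto simp: two_path_digraph_def\<close>)
  have img_phi: "phi ` verts ?F = (!) vp ` \<sigma> ` {..a} \<union> (!) vq ` \<tau> ` {..b}"
  proof -
    have "phi ` {..a} = (!) vp ` \<sigma> ` {..a}" by (auto simp: phi_def image_image)
    moreover have "phi ` (\<lambda>i. a + i) ` {0<..<b} = (!) vq ` \<tau> ` {0<..<b}"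
      unfolding image_image by (intro image_cong) (auto simp: phi_def)
    moreover have "vq ! \<tau> 0 = vp ! \<sigma> 0" "vq ! \<tau> b = vp ! \<sigma> a"
      using \<sigma>_ends \<tau>_ends ends by simp_all
    moreover have "{..b} = insert 0 (insert b {0<..<b})" by auto
    ultimately show ?thesis
      unfolding verts_F image_Un by auto
  qed
  have vp_inj: "inj_on ((!) vp) {..length p}" and vq_inj: "inj_on ((!) vq) {..length q}"
    using dist len by (auto simp: inj_on_def nth_eq_iff_index_eq)
  have p_inj: "inj_on ((!) p) {..<length p}" and q_inj: "inj_on ((!) q) {..<length q}"
    using \<open>distinct p\<close> \<open>distinct q\<close> by (auto simp: inj_on_def nth_eq_iff_index_eq)
  have \<sigma>_le: "\<sigma> i \<le> length p" and \<tau>_le: "\<tau> j \<le> length q" for i j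
    using cut_le ab by (auto simp: \<sigma>_def \<tau>_def)
  have inner_cross: "vp ! m \<noteq> vq ! n"
    if "m \<le> length p" "n \<le> length q" "0 < m \<and> m < length p \<or> 0 < n \<and> n < length q" for m n
    using cross[of m n] that by auto

  have inj_phi: "inj_on phi (verts ?F)"
  proof -
    have "inj_on phi {..a}"
    proof -
      have "inj_on (\<lambda>i. vp ! \<sigma> i) {..a}"
        using comp_inj_on[of \<sigma> "{..a}" "(!) vp"] cut_inj[OF ab(2)] \<sigma>_le
        by (auto simp: \<sigma>_def comp_def intro: inj_on_subset[OF vp_inj])
      then show ?thesis using phi_p by (auto simp: inj_on_def)
    qed
    moreover have "inj_on phi ((\<lambda>i. a + i) ` {0<..<b})"
    proof -
      have "inj_on (\<lambda>i. vq ! \<tau> i) {..b}"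
        using comp_inj_on[of \<tau> "{..b}" "(!) vq"] cut_inj[OF ab(4)] \<tau>_le
        by (auto simp: \<tau>_def comp_def intro: inj_on_subset[OF vq_inj])
      then show ?thesis by (auto simp: inj_on_def phi_def)
    qed
    moreover have "phi i \<noteq> phi (a + j)" if "i \<le> a" "0 < j" "j < b" for i j
    proof -
      have "\<tau> j = j" "j < length q" using that ab by (auto simp: \<tau>_def cut_def)
      then show ?thesis
        using that inner_cross[of "\<sigma> i" "\<tau> j"] \<sigma>_le by (auto simp: phi_def)
    qed
    ultimately show ?thesis unfolding verts_F by (auto simp: inj_on_Un)
  qed

  have inner_p: "0 < m" "m < length p" if "e < a" "m \<in> {\<sigma> e<..<\<sigma> (Suc e)}" for e m
    using that \<sigma>(2)[OF that(1)] by auto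
  have inner_q: "0 < m" "m < length q" if "e < b" "m \<in> {\<tau> e<..<\<tau> (Suc e)}" for e m
    using that \<tau>(2)[OF that(1)] by auto

  \<comment> \<open>A position inside a segment is no cut position of the same path, by
    \<open>cut_gap\<close>, and its vertex is not on the other path, by
    \<open>inner_cross\<close>.\<close>
  have avoid_p: "set (inner_verts (P e)) \<inter> phi ` verts ?F = {}" if "e < a" for e
  proof -
    have "vp ! m \<noteq> vp ! \<sigma> i" if "m \<in> {\<sigma> e<..<\<sigma> (Suc e)}" "i \<le> a" for m i
      using inj_onD[OF vp_inj, of m "\<sigma> i"] cut_gap[OF ab(2) that(2) \<open>e < a\<close>] that
        inner_p[OF \<open>e < a\<close> that(1)] \<sigma>_le by (auto simp: \<sigma>_def)
    moreover have "vp ! m \<noteq> vq ! \<tau> i" if "m \<in> {\<sigma> e<..<\<sigma> (Suc e)}" for m i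
      using inner_cross[of m "\<tau> i"] inner_p[OF \<open>e < a\<close> that] \<tau>_le by auto
    ultimately show ?thesis unfolding first(2)[OF that] img_phi by blast
  qed
  have avoid_q: "set (inner_verts (P (a + e))) \<inter> phi ` verts ?F = {}" if "e < b" for e
  proof -
    have "vq ! m \<noteq> vq ! \<tau> i" if "m \<in> {\<tau> e<..<\<tau> (Suc e)}" "i \<le> b" for m i
      using inj_onD[OF vq_inj, of m "\<tau> i"] cut_gap[OF ab(4) that(2) \<open>e < b\<close>] that
        inner_q[OF \<open>e < b\<close> that(1)] \<tau>_le by (auto simp: \<tau>_def)
    moreover have "vq ! m \<noteq> vp ! \<sigma> i" if "m \<in> {\<tau> e<..<\<tau> (Suc e)}" for m i
      using inner_cross[of "\<sigma> i" m] inner_q[OF \<open>e < b\<close> that] \<sigma>_le by fastforce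
    ultimately show ?thesis unfolding second(2)[OF that] img_phi by blast
  qed

  have disj_pp: "set (inner_verts (P d)) \<inter> set (inner_verts (P e)) = {} \<and>
      set (P d) \<inter> set (P e) = {}"
    if "d < a" "e < a" "d \<noteq> e" for d e
  proof
    have disj: "{\<sigma> d..<\<sigma> (Suc d)} \<inter> {\<sigma> e..<\<sigma> (Suc e)} = {}"
      using cut_disjoint[OF ab(2) that] by (simp add: \<sigma>_def)
    moreover have "{\<sigma> d<..<\<sigma> (Suc d)} \<subseteq> {\<sigma> d..<\<sigma> (Suc d)}"
      "{\<sigma> e<..<\<sigma> (Suc e)} \<subseteq> {\<sigma> e..<\<sigma> (Suc e)}" by auto
    ultimately have "{\<sigma> d<..<\<sigma> (Suc d)} \<inter> {\<sigma> e<..<\<sigma> (Suc e)} = {}" by blast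
    then show "set (inner_verts (P d)) \<inter> set (inner_verts (P e)) = {}"
      using \<sigma>(2)[OF that(1)] \<sigma>(2)[OF that(2)]
      unfolding first(2)[OF that(1)] first(2)[OF that(2)]
      by (subst inj_on_image_Int[OF vp_inj, symmetric]) auto
    show "set (P d) \<inter> set (P e) = {}"
      using disj \<sigma>(2)[OF that(1)] \<sigma>(2)[OF that(2)]
      unfolding first(3)[OF that(1)] first(3)[OF that(2)]
      by (subst inj_on_image_Int[OF p_inj, symmetric]) auto
  qed
  have disj_qq: "set (inner_verts (P (a + d))) \<inter> set (inner_verts (P (a + e))) = {} \<and>
      set (P (a + d)) \<inter> set (P (a + e)) = {}"
    if "d < b" "e < b" "d \<noteq> e" for d e
  proof
    have disj: "{\<tau> d..<\<tau> (Suc d)} \<inter> {\<tau> e..<\<tau> (Suc e)} = {}"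
      using cut_disjoint[OF ab(4) that] by (simp add: \<tau>_def)
    moreover have "{\<tau> d<..<\<tau> (Suc d)} \<subseteq> {\<tau> d..<\<tau> (Suc d)}"
      "{\<tau> e<..<\<tau> (Suc e)} \<subseteq> {\<tau> e..<\<tau> (Suc e)}" by auto
    ultimately have "{\<tau> d<..<\<tau> (Suc d)} \<inter> {\<tau> e<..<\<tau> (Suc e)} = {}" by blast
    then show "set (inner_verts (P (a + d))) \<inter> set (inner_verts (P (a + e))) = {}"
      using \<tau>(2)[OF that(1)] \<tau>(2)[OF that(2)]
      unfolding second(2)[OF that(1)] second(2)[OF that(2)]
      by (subst inj_on_image_Int[OF vq_inj, symmetric]) auto
    show "set (P (a + d)) \<inter> set (P (a + e)) = {}"
      using disj \<tau>(2)[OF that(1)] \<tau>(2)[OF that(2)]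
      unfolding second(3)[OF that(1)] second(3)[OF that(2)]
      by (subst inj_on_image_Int[OF q_inj, symmetric]) auto
  qed
  have disj_pq: "set (inner_verts (P d)) \<inter> set (inner_verts (P (a + e))) = {} \<and>
      set (P d) \<inter> set (P (a + e)) = {}"
    if "d < a" "e < b" for d e
  proof
    show "set (inner_verts (P d)) \<inter> set (inner_verts (P (a + e))) = {}"
    proof -
      have "vp ! m \<noteq> vq ! n" if "m \<in> {\<sigma> d<..<\<sigma> (Suc d)}" "n \<in> {\<tau> e<..<\<tau> (Suc e)}" for m n
        using inner_cross[of m n] inner_p[OF \<open>d < a\<close> that(1)] inner_q[OF \<open>e < b\<close> that(2)] by auto
      then show ?thesis
        unfolding first(2)[OF that(1)] second(2)[OF that(2)] by blast
    qed
    have "set (P d) \<subseteq> set p" "set (P (a + e)) \<subseteq> set q"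
      by (auto simp: P_def that dest: in_set_takeD in_set_dropD)
    then show "set (P d) \<inter> set (P (a + e)) = {}" using arcs_disj by blast
  qed
  have disj_arcs: "set (inner_verts (P e)) \<inter> set (inner_verts (P f)) = {} \<and> set (P e) \<inter> set (P f) = {}"
    if "e \<in> arcs ?F" "f \<in> arcs ?F" "e \<noteq> f" for e f
  proof -
    have "e < a \<or> (\<exists>i<b. e = a + i)" "f < a \<or> (\<exists>i<b. f = a + i)"
      using that(1,2) unfolding arcs_F by auto
    then consider "e < a" "f < a" | i j where "e = a + i" "f = a + j" "i < b" "j < b"
      | j where "e < a" "f = a + j" "j < b" | i where "e = a + i" "f < a" "i < b"
      by blast
    then show ?thesis
    proof cases
      case 1
      then show ?thesis using disj_pp that(3) by blast
    next
      case 2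
      then show ?thesis using disj_qq that(3) by auto
    next
      case 3
      then show ?thesis using disj_pq by blast
    next
      case 4
      then show ?thesis using disj_pq[of f i] by (simp add: Int_commute)
    qed
  qed

  have path_e: "P e \<noteq> [] \<and> pre_digraph.apath H (phi (tail ?F e)) (P e) (phi (head ?F e)) \<and>
      set (inner_verts (P e)) \<inter> phi ` verts ?F = {}" if "e \<in> arcs ?F" for e
  proof -
    have "e < a \<or> (\<exists>i<b. e = a + i)" using that unfolding arcs_F by auto
    then consider "e < a" | i where "i < b" "e = a + i" by blast
    then show ?thesis
    proof cases
      case 1
      then have "tail ?F e = e" "head ?F e = Suc e"
        using ab by (auto simp: two_path_digraph_def)
      then show ?thesis using first[OF 1] avoid_p[OF 1] phi_p[of e] phi_p[of "Suc e"] 1 by simp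
    next
      case 2
      then have "tail ?F e = (if i = 0 then 0 else if i = b then a else a + i)"
        "head ?F e = (if Suc i = 0 then 0 else if Suc i = b then a else a + Suc i)"
        by (auto simp: two_path_digraph_def)
      then show ?thesis
        using second[OF 2(1)] avoid_q[OF 2(1)] phi_q[of i] phi_q[of "Suc i"] 2 by simp
    qed
  qed

  have verts_H: "verts H = phi ` verts ?F \<union> (\<Union>e\<in>arcs ?F. set (inner_verts (P e)))"
  proof -
    have "set vp = (!) vp ` {..length p}" "set vq = (!) vq ` {..length q}"
      using len by (auto simp: set_conv_nth less_Suc_eq_le)
    then show ?thesis
      unfolding arcs_F img_phi cut_cover(2)[OF ab(1,2)] cut_cover(2)[OF ab(3,4)]
      by (simp add: H_def first(2) second(2) UN_Un image_Un image_UN \<sigma>_def \<tau>_def Un_ac)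
  qed
  have arcs_H: "arcs H = (\<Union>e\<in>arcs ?F. set (P e))"
  proof -
    have "set p = (!) p ` {..<length p}" "set q = (!) q ` {..<length q}"
      by (auto simp: set_conv_nth)
    then show ?thesis
      unfolding arcs_F cut_cover(1)[OF ab(1,2)] cut_cover(1)[OF ab(3,4)]
      by (simp add: H_def first(3) second(3) UN_Un image_UN \<sigma>_def \<tau>_def)
  qed
  have "directed_subdivision ?F H"
    unfolding directed_subdivision_def inner_H
    using wf_two_path_digraph[OF ab(1,3)] wfH inj_phi path_e disj_arcs verts_H arcs_H
    by blast
  then show ?thesis using subH unfolding contains_subdivision_def by blast
qed

end

section \<open>Passing between arcs and vertices\<close>

context digraph
begin

abbreviation adj :: "'a \<Rightarrow> 'a \<Rightarrow> bool" where
  "adj u v \<equiv> (u, v) \<in> arcs_ends G"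

lemma successively_adj_imp_awalk:
  assumes "successively adj xs" "xs \<noteq> []" "hd xs \<in> verts G"
  shows "\<exists>p. awalk (hd xs) p (last xs) \<and> awalk_verts (hd xs) p = xs"
  using assms
proof (induction xs)
  case (Cons x xs)
  show ?case
  proof (cases xs)
    case Nil
    then have "awalk (hd (x # xs)) [] (last (x # xs)) \<and> awalk_verts (hd (x # xs)) [] = x # xs"
      using Cons.prems by (simp add: awalk_Nil_iff)
    then show ?thesis by blast
  next
    case xs: (Cons y ys)
    then obtain e where e: "e \<in> arcs G" "tail G e = x" "head G e = y"
      using Cons.prems by (auto simp: arcs_ends_conv)
    have "y \<in> verts G" using e by auto
    then obtain p where "awalk y p (last xs)" "awalk_verts y p = xs"
      using Cons xs by auto
    then have "awalk (hd (x # xs)) (e # p) (last (x # xs)) \<and> awalk_verts (hd (x # xs)) (e # p) = x # xs"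
      using e xs by (simp add: awalk_Cons_iff)
    then show ?thesis by blast
  qed
qed simp

lemma dipath_imp_apath:
  assumes "dipath adj u xs v" "u \<in> verts G"
  obtains p where "apath u p v" "awalk_verts u p = xs" "length xs = Suc (length p)"
proof -
  obtain p where "awalk u p v" "awalk_verts u p = xs"
    using assms successively_adj_imp_awalk[of xs] by (auto simp: dipath_def)
  then show ?thesis
    using assms that[of p] length_awalk_verts[of u p] by (auto simp: dipath_def apath_def)
qed

lemma girth_dipath:
  assumes "dipath adj u xs v" "adj v u" "enat g \<le> digirth G"
  shows "g \<le> length xs"
proof -
  obtain e where e: "e \<in> arcs G" "tail G e = v" "head G e = u"
    using assms(2) by (auto simp: arcs_ends_conv)
  then have "u \<in> verts G" by auto
  obtain p where p: "apath u p v" "length xs = Suc (length p)"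
    using dipath_imp_apath[OF assms(1) \<open>u \<in> verts G\<close>] by blast
  \<comment> \<open>With the closing arc in front, \<open>tl\<close> removes one of the two
    occurrences of \<open>v\<close>, and the cycle has as many arcs as \<open>xs\<close> has
    vertices.\<close>
  have "awalk v (e # p) v" "distinct (tl (awalk_verts v (e # p)))"
    using p e by (auto simp: awalk_Cons_iff apath_def)
  then have "cycle (e # p)" by (auto simp: cycle_def)
  then have "digirth G \<le> enat (length (e # p))"
    unfolding digirth_def by (intro INF_lower) auto
  then show ?thesis using assms(3) p by (metis enat_ord_simps(1) length_Cons order_trans)
qed

text \<open>Without parallel arcs, distinct arcs leaving \<open>u\<close> have distinct
  heads.\<close>

lemma two_out_neighbours:
  assumes "2 \<le> out_degree G u"
  shows "\<exists>v w. v \<noteq> w \<and> adj u v \<and> adj u w"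
proof -
  have "\<not> card (out_arcs G u) \<le> Suc 0" using assms by (simp add: out_degree_def)
  then obtain e f where "e \<in> out_arcs G u" "f \<in> out_arcs G u" "e \<noteq> f"
    using card_le_Suc0_iff_eq[OF finite_out_arcs[of u]] by blast
  then have "adj u (head G e)" "adj u (head G f)" "head G e \<noteq> head G f"
    using no_multi_arcs[of e f] in_arcs_imp_in_arcs_ends[of e] in_arcs_imp_in_arcs_ends[of f]
    by (auto simp: out_arcs_def arc_to_ends_def)
  then show ?thesis by blast
qed

lemma contains_two_path_subdivision_of_dipaths:
  assumes A: "dipath adj x A y" and B: "dipath adj x B y" and AB: "set A \<inter> set B = {x, y}"
    and "2 \<le> k" "k < length A" "k < length B"
  shows "contains_subdivision G (two_path_digraph k k)"
proof -
  have "x \<in> verts G"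
  proof -
    \<comment> \<open>The rule splits lists into those with no, one, and at least two entries; the
      arc found from \<open>x\<close> to \<open>z\<close> shows that \<open>x\<close> is a
      vertex.\<close>
    obtain z A' where "A = x # z # A'"
      using A assms(4,5) by (cases A rule: remdups_adj.cases) (auto simp: dipath_def)
    then have "adj x z" using A by (simp add: dipath_def)
    then show ?thesis by (auto simp: arcs_ends_conv)
  qed
  obtain p where p: "apath x p y" "awalk_verts x p = A" "length A = Suc (length p)"
    using dipath_imp_apath[OF A \<open>x \<in> verts G\<close>] .
  obtain q where q: "apath x q y" "awalk_verts x q = B" "length B = Suc (length q)"
    using dipath_imp_apath[OF B \<open>x \<in> verts G\<close>] .
  \<comment> \<open>A common arc would have both ends in \<open>{x, y}\<close>. As \<open>p\<close>
    has at least two arcs, only its first arc has its tail in \<open>{x, y}\<close>, and the head of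
    that arc is an inner vertex.\<close>
  have "set p \<inter> set q = {}"
  proof (rule ccontr)
    assume "set p \<inter> set q \<noteq> {}"
    then obtain e where e: "e \<in> set p" "e \<in> set q" by auto
    then have "tail G e \<in> {x, y}" "head G e \<in> {x, y}" "e \<in> arcs G"
      using AB p q awalk_verts_arc1 awalk_verts_arc2 awalkI_apath by blast+
    moreover obtain e0 e1 p' where p_eq: "p = e0 # e1 # p'"
      using p(3) assms(4,5) by (cases p rule: remdups_adj.cases) auto
    moreover have tail_ne: "tail G f \<noteq> y" if "f \<in> set p" for f
    proof -
      have "y = head G (last p)" "p \<noteq> []"
        using awlast_if_cas[of x p y] p(1) p_eq by (auto simp: apath_def awalk_verts_conv)
      then have "y \<notin> tail G ` set p" using p(1) by (auto simp: apath_def awalk_verts_conv)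
      then show ?thesis using that by blast
    qed
    moreover have "tail G f \<noteq> x" if "f \<in> set (e1 # p')" for f
      using p(1) awalk_verts_arc1[OF that, of "head G e0"] by (auto simp: p_eq apath_Cons_iff)
    ultimately have "e = e0" using e(1) by auto
    moreover have "head G e0 = tail G e1" "tail G e1 \<noteq> x" "tail G e1 \<noteq> y"
      using p(1) tail_ne[of e1] by (auto simp: p_eq apath_Cons_iff)
    ultimately show False using \<open>head G e \<in> {x, y}\<close> by auto
  qed
  then show ?thesis
    using p q assms by (intro contains_two_path_subdivision[of x p y q]) auto
qed

end

theorem theorem7:
  fixes D :: "('a, 'b) pre_digraph" and k :: nat
  assumes "k \<ge> 2"
    and "digraph D"
    and "verts D \<noteq> {}"
    and "min_out_degree D \<ge> 2"
    and "digirth D \<ge> enat (8 * k - 6)"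
  shows "contains_subdivision D (two_path_digraph k k)"
proof -
  interpret digraph D by fact
  have two_succ: "\<exists>v w. v \<noteq> w \<and> adj u v \<and> adj u w" if "u \<in> verts D" for u
  proof (rule two_out_neighbours)
    have "min_out_degree D \<le> out_degree D u"
      unfolding min_out_degree_def using that by (intro Min_le) auto
    then show "2 \<le> out_degree D u" using assms(4) by linarith
  qed
  have "v \<in> verts D" if "adj u v" for u v
    using that by (auto simp: arcs_ends_conv)
  moreover have "\<not> adj u u" for u
    using no_loops by (auto simp: arcs_ends_conv)
  ultimately obtain S c R s where S: "minimal_exit_set adj S c"
    and R: "dipath adj c R s" "set R \<inter> S = {s}"
    using minimal_exit_set_exists[of "verts D" adj] two_succ assms(3) by auto
  \<comment> \<open>\<open>2 * k - 1 \<le> 8 * k - 6\<close> holds because \<open>k\<close> is at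
    least 2.\<close>
  have "enat (2 * k - 1) \<le> digirth D"
    using assms(1,5) by (elim order_trans[rotated]) simp
  then have "2 * k - 1 \<le> length xs" if "dipath adj u xs v" "adj v u" for u xs v
    using girth_dipath that by blast
  then obtain x A y B where "dipath adj x A y" "dipath adj x B y" "set A \<inter> set B = {x, y}"
    "k < length A" "k < length B"
    using minimal_exit_set.long_disjoint_paths[OF S assms(1) _ R] by blast
  then show ?thesis
    using contains_two_path_subdivision_of_dipaths assms(1) by blast
qed

end
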